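(* Let $\mathcal I$ be a small step alternating pushdown system and $\overline{\mathcal I}$ its complementation (defined below). A configuration has a co-inductive proof in $\overline{\mathcal I}$ if and only if it has no proof in $\mathcal I$.
   Context: Fix a language with finitely many unary predicate symbols (states), finitely many unary function symbols (stack symbols), a constant $\varepsilon$ and a variable $x$. Words are closed terms $\gamma_1(\cdots\gamma_n(\varepsilon))$; configurations are atomic propositions $P(w)$ with $P$ a state and $w$ a word. For an inference system $\mathcal J$ (a set of rules $\frac{A_1\cdots A_n}{B}$ with atomic premises and conclusion, possibly containing $x$): a proof of a configuration $A$ is a finite tree labeled by configurations with root $A$ such that each node is labeled $\sigma B$ and its children $\sigma A_1,\dots,\sigma A_n$ for some rule $\frac{A_1\cdots A_n}{B}\in\mathcal J$ and some substitution $\sigma$ of a word for $x$; a co-inductive proof is the same except that the tree may be finite or infinite. Rule types: an introduction rule is $\frac{P_1(x)\cdots P_n(x)}{Q(\gamma x)}$ ($\gamma$ a stack symbol, $n\ge0$) or $\frac{}{Q(\varepsilon)}$; an elimination rule is $\frac{P_1(\gamma x)\ P_2(x)\cdots P_n(x)}{Q(x)}$ ($n\ge1$); a neutral rule is $\frac{P_1(x)\cdots P_n(x)}{Q(x)}$ ($n\ge0$). A small step alternating pushdown system is a finite set of introduction, elimination and neutral rules. $\tilde{\mathcal I}$ is obtained from $\mathcal I$ by keeping the introduction rules and replacing each neutral or elimination rule (with conclusion $P(x)$) by its instance with $x:=\varepsilon$ and, for each stack symbol $\gamma$, its instance with $x:=\gamma x$. Let $\mathcal C$ be the set of all $P(\varepsilon)$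 and $P(\gamma x)$. The complementation $\overline{\mathcal I}$: for each $B\in\mathcal C$, if $r_1,\dots,r_n$ ($n\ge0$) are the rules of $\tilde{\mathcal I}$ with conclusion $B$, $r_i$ having premises $A^i_1,\dots,A^i_{m_i}$, then $\overline{\mathcal I}$ contains the rules $\frac{A^1_{j_1}\ \cdots\ A^n_{j_n}}{B}$ for all choices $1\le j_i\le m_i$ (the single rule $\frac{}{B}$ if $n=0$). *)

theory Defs imports Main
begin

datatype 'g trm = Var | Epsilon | App 'g "'g trm"

datatype ('p, 'g) atom = Atom 'p "'g trm"

datatype ('p, 'g) rule =
  Rule (prems: "('p, 'g) atom list") (concl: "('p, 'g) atom")

fun subst_trm :: "'g trm \<Rightarrow> 'g trm \<Rightarrow> 'g trm" where
  "subst_trm t Var = t"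
| "subst_trm t Epsilon = Epsilon"
| "subst_trm t (App g u) = App g (subst_trm t u)"

fun subst_atom :: "'g trm \<Rightarrow> ('p, 'g) atom \<Rightarrow> ('p, 'g) atom" where
  "subst_atom t (Atom p u) = Atom p (subst_trm t u)"

fun subst_rule :: "'g trm \<Rightarrow> ('p, 'g) rule \<Rightarrow> ('p, 'g) rule" where
  "subst_rule t (Rule As B) = Rule (map (subst_atom t) As) (subst_atom t B)"

(* The language is given by a set Q of states and a set \<Gamma> of stack symbols,
   rather than by finite types, so that either set may be empty. *)

inductive word :: "'g set \<Rightarrow> 'g trm \<Rightarrow> bool" for \<Gamma> where
  "word \<Gamma> Epsilon"
| "g \<in> \<Gamma> \<Longrightarrow> word \<Gamma> w \<Longrightarrow> word \<Gamma> (App g w)"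

definition configuration :: "'p set \<Rightarrow> 'g set \<Rightarrow> ('p, 'g) atom \<Rightarrow> bool" where
  "configuration Q \<Gamma> A \<longleftrightarrow> (\<exists>p w. A = Atom p w \<and> p \<in> Q \<and> word \<Gamma> w)"

codatatype 'a tree = Node (label: 'a) (children: "'a tree list")

inductive_set subtrees :: "'a tree \<Rightarrow> 'a tree set" for t where
  "t \<in> subtrees t"
| "s \<in> subtrees t \<Longrightarrow> u \<in> set (children s) \<Longrightarrow> u \<in> subtrees t"

(* Finitely branching and well-founded, that is, finitely many nodes.  Finiteness of
   "subtrees t" would be too weak: it also holds for infinite regular trees. *)
inductive finite_tree :: "'a tree \<Rightarrow> bool" where
  "(\<And>s. s \<in> set (children t) \<Longrightarrow> finite_tree s) \<Longrightarrow> finite_tree t"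

definition derivation_tree ::
  "'p set \<Rightarrow> 'g set \<Rightarrow> ('p, 'g) rule set \<Rightarrow> ('p, 'g) atom tree \<Rightarrow> bool" where
  "derivation_tree Q \<Gamma> J t \<longleftrightarrow>
     (\<forall>s \<in> subtrees t. configuration Q \<Gamma> (label s) \<and>
        (\<exists>r \<in> J. \<exists>w. word \<Gamma> w \<and>
           label s = subst_atom w (concl r) \<and>
           map label (children s) = map (subst_atom w) (prems r)))"

definition has_coinductive_proof ::
  "'p set \<Rightarrow> 'g set \<Rightarrow> ('p, 'g) rule set \<Rightarrow> ('p, 'g) atom \<Rightarrow> bool" where
  "has_coinductive_proof Q \<Gamma> J A \<longleftrightarrow> (\<exists>t. label t = A \<and> derivation_tree Q \<Gamma> J t)"

definition has_proof ::
  "'p set \<Rightarrow> 'g set \<Rightarrow> ('p, 'g) rule set \<Rightarrow> ('p, 'g) atom \<Rightarrow> bool" where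
  "has_proof Q \<Gamma> J A \<longleftrightarrow>
     (\<exists>t. label t = A \<and> derivation_tree Q \<Gamma> J t \<and> finite_tree t)"

definition introduction_rules :: "'p set \<Rightarrow> 'g set \<Rightarrow> ('p, 'g) rule set" where
  "introduction_rules Q \<Gamma> =
     {Rule (map (\<lambda>p. Atom p Var) ps) (Atom q (App g Var)) | ps q g.
        set ps \<subseteq> Q \<and> q \<in> Q \<and> g \<in> \<Gamma>} \<union>
     {Rule [] (Atom q Epsilon) | q. q \<in> Q}"

definition elimination_rules :: "'p set \<Rightarrow> 'g set \<Rightarrow> ('p, 'g) rule set" where
  "elimination_rules Q \<Gamma> =
     {Rule (Atom p (App g Var) # map (\<lambda>p. Atom p Var) ps) (Atom q Var) | p g ps q.
        p \<in> Q \<and> g \<in> \<Gamma> \<and> set ps \<subseteq> Q \<and> q \<in> Q}"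

definition neutral_rules :: "'p set \<Rightarrow> ('p, 'g) rule set" where
  "neutral_rules Q =
     {Rule (map (\<lambda>p. Atom p Var) ps) (Atom q Var) | ps q. set ps \<subseteq> Q \<and> q \<in> Q}"

definition small_step_APDS :: "'p set \<Rightarrow> 'g set \<Rightarrow> ('p, 'g) rule set \<Rightarrow> bool" where
  "small_step_APDS Q \<Gamma> I \<longleftrightarrow>
     finite I \<and> I \<subseteq> introduction_rules Q \<Gamma> \<union> elimination_rules Q \<Gamma> \<union> neutral_rules Q"

(* The system written I with a tilde in the literature. *)
definition expansion :: "'p set \<Rightarrow> 'g set \<Rightarrow> ('p, 'g) rule set \<Rightarrow> ('p, 'g) rule set" where
  "expansion Q \<Gamma> I =
     (I \<inter> introduction_rules Q \<Gamma>) \<union>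
     {subst_rule t r | t r.
        r \<in> I \<inter> (neutral_rules Q \<union> elimination_rules Q \<Gamma>) \<and>
        (t = Epsilon \<or> (\<exists>g \<in> \<Gamma>. t = App g Var))}"

definition base_conclusions :: "'p set \<Rightarrow> 'g set \<Rightarrow> ('p, 'g) atom set" where
  "base_conclusions Q \<Gamma> =
     {Atom p Epsilon | p. p \<in> Q} \<union> {Atom p (App g Var) | p g. p \<in> Q \<and> g \<in> \<Gamma>}"

(* rs ranges over all enumerations r_1, ..., r_n without repetition of the rules with
   conclusion B, and As picks one premise of each; different enumerations only permute
   the premises of the resulting rules. *)
definition complementation ::
  "'p set \<Rightarrow> 'g set \<Rightarrow> ('p, 'g) rule set \<Rightarrow> ('p, 'g) rule set" where
  "complementation Q \<Gamma> I =
     {Rule As B | As B rs.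
        B \<in> base_conclusions Q \<Gamma> \<and>
        distinct rs \<and> set rs = {r \<in> expansion Q \<Gamma> I. concl r = B} \<and>
        list_all2 (\<lambda>A r. A \<in> set (prems r)) As rs}"

end

(* A rule of the complementation with conclusion B selects one premise from each rule that could
   prove B.  So if a configuration had both a finite proof in I and a co-inductive proof in the
   complementation, the last rule of the former would share a premise with the first step of
   the latter, and descending along shared premises contradicts the finiteness of the first tree.
   Conversely, every rule instance concluding an unprovable configuration has an unprovable
   premise; selecting such premises gives a rule of the complementation, and iterating this
   choice unfolds a co-inductive proof. *)

theory Submission imports Defs
begin

section \<open>Derivation trees: local checking and grafting\<close>

text \<open>Every subtree is reached from the root in finitely many steps to a child, so an
  invariant inherited by children reaches all of them. This lets infinite trees be checked one node
  at a time.\<close>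

lemma derivation_tree_coinduct:
  assumes "X t"
    and step: "\<And>s. X s \<Longrightarrow> configuration Q \<Gamma> (label s) \<and>
        (\<exists>r \<in> J. \<exists>w. word \<Gamma> w \<and> label s = subst_atom w (concl r) \<and>
           map label (children s) = map (subst_atom w) (prems r)) \<and>
        (\<forall>u \<in> set (children s). X u)"
  shows "derivation_tree Q \<Gamma> J t"
proof -
  have "X s" if "s \<in> subtrees t" for s
    using that
  proof induction
    case 1
    show ?case by fact
  next
    case (2 s u)
    then show ?case using step[of s] by simp
  qed
  then show ?thesis
    unfolding derivation_tree_def using step by simp
qed

text \<open>\<open>subtrees\<close> is generated by extending a path at its lower end; here the path
  is extended at the root, which is what passing from a derivation to its immediate subderivations
  requires.\<close>

lemma subtrees_child:
  assumes "u \<in> set (children t)" and "s \<in> subtrees u"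
  shows "s \<in> subtrees t"
  using assms(2)
proof induction
  case 1
  show ?case
    using subtrees.intros(1) assms(1) by (rule subtrees.intros(2))
next
  case (2 s v)
  show ?case
    using 2(3,2) by (rule subtrees.intros(2))
qed

lemma derivation_tree_child:
  "derivation_tree Q \<Gamma> J t \<Longrightarrow> u \<in> set (children t) \<Longrightarrow> derivation_tree Q \<Gamma> J u"
  unfolding derivation_tree_def using subtrees_child by blast

lemma derivation_tree_root:
  assumes "derivation_tree Q \<Gamma> J t"
  obtains r w where "r \<in> J" "word \<Gamma> w" "label t = subst_atom w (concl r)"
    "map label (children t) = map (subst_atom w) (prems r)"
  using assms subtrees.intros(1)[of t] unfolding derivation_tree_def by blast

text \<open>Choosing a finite proof for each premise and grafting these below a new root gives a
  finite proof. It is used in contrapositive form: an unprovable conclusion forces an unprovable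
  premise.\<close>

lemma has_proof_step:
  assumes r: "r \<in> J" "word \<Gamma> w" and A: "configuration Q \<Gamma> (subst_atom w (concl r))"
    and prems: "\<And>P. P \<in> set (prems r) \<Longrightarrow> has_proof Q \<Gamma> J (subst_atom w P)"
  shows "has_proof Q \<Gamma> J (subst_atom w (concl r))"
proof -
  have "\<exists>f. \<forall>P \<in> set (prems r). label (f P) = subst_atom w P \<and> derivation_tree Q \<Gamma> J (f P)
      \<and> finite_tree (f P)"
    using prems unfolding has_proof_def by (intro bchoice) blast
  then obtain f where f: "\<forall>P \<in> set (prems r). label (f P) = subst_atom w P \<and>
      derivation_tree Q \<Gamma> J (f P) \<and> finite_tree (f P)" ..
  let ?t = "Node (subst_atom w (concl r)) (map f (prems r))"
  have "finite_tree ?t"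
    by (rule finite_tree.intros) (use f in auto)
  moreover have "derivation_tree Q \<Gamma> J ?t"
  \<comment> \<open>Only the new root needs a fresh check; everything below it falls under the
    second disjunct.\<close>
  proof (rule derivation_tree_coinduct[where X = "\<lambda>s. s = ?t \<or> derivation_tree Q \<Gamma> J s"])
    fix s
    assume "s = ?t \<or> derivation_tree Q \<Gamma> J s"
    then show "configuration Q \<Gamma> (label s) \<and>
        (\<exists>r \<in> J. \<exists>w. word \<Gamma> w \<and> label s = subst_atom w (concl r) \<and>
           map label (children s) = map (subst_atom w) (prems r)) \<and>
        (\<forall>u \<in> set (children s). u = ?t \<or> derivation_tree Q \<Gamma> J u)"
    proof
      assume s: "s = ?t"
      have "map label (children s) = map (subst_atom w) (prems r)"
        using f s by simp
      moreover have "label s = subst_atom w (concl r)"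
        using s by simp
      moreover have "\<forall>u \<in> set (children s). derivation_tree Q \<Gamma> J u"
        using f s by simp
      ultimately show ?thesis
        using r A by metis
    next
      assume s: "derivation_tree Q \<Gamma> J s"
      then show ?thesis
        using derivation_tree_child[OF s] subtrees.intros(1)[of s]
        unfolding derivation_tree_def by blast
    qed
  qed simp
  ultimately show ?thesis
    unfolding has_proof_def by (intro exI[of _ ?t]) simp
qed

section \<open>Rule instances of a system and of its expansion\<close>

lemma subst_trm_comp: "subst_trm u (subst_trm t v) = subst_trm (subst_trm u t) v"
  by (induction v) auto

lemma subst_atom_comp: "subst_atom u (subst_atom t A) = subst_atom (subst_trm u t) A"
  by (cases A) (simp add: subst_trm_comp)

lemma premise_configuration:
  assumes "small_step_APDS Q \<Gamma> I" "r \<in> I" "word \<Gamma> w" "P \<in> set (prems r)"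
  shows "configuration Q \<Gamma> (subst_atom w P)"
proof -
  have "r \<in> introduction_rules Q \<Gamma> \<union> elimination_rules Q \<Gamma> \<union> neutral_rules Q"
    using assms unfolding small_step_APDS_def by blast
  then show ?thesis
    using assms(3,4)
    by (auto simp: introduction_rules_def elimination_rules_def neutral_rules_def
        configuration_def subset_iff intro!: word.intros(2))
qed

lemma neutral_elimination_concl:
  assumes "r \<in> neutral_rules Q \<union> elimination_rules Q \<Gamma>"
  obtains q where "q \<in> Q" "concl r = Atom q Var"
  using assms by (auto simp: neutral_rules_def elimination_rules_def)

lemma concl_subst_rule: "concl (subst_rule t r) = subst_atom t (concl r)"
  by (cases r) simp

lemma prems_subst_rule: "prems (subst_rule t r) = map (subst_atom t) (prems r)"
  by (cases r) simp

text \<open>If \<open>r\<close> is an introduction rule, its conclusion must already be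
  \<open>B\<close>, and \<open>r\<close> itself serves. Otherwise its conclusion is a state applied
  to the variable, so \<open>w\<close> factors through the term \<open>t\<close> of \<open>B\<close>
  as \<open>subst_trm u t\<close>, and \<open>subst_rule t r\<close> serves.\<close>

lemma expansion_of_instance:
  assumes I: "small_step_APDS Q \<Gamma> I" "r \<in> I"
    and B: "B \<in> base_conclusions Q \<Gamma>"
    and eq: "subst_atom w (concl r) = subst_atom u B"
  obtains r' where "r' \<in> expansion Q \<Gamma> I" "concl r' = B"
    "map (subst_atom u) (prems r') = map (subst_atom w) (prems r)"
proof -
  consider "r \<in> introduction_rules Q \<Gamma>" | "r \<in> neutral_rules Q \<union> elimination_rules Q \<Gamma>"
    using I unfolding small_step_APDS_def by blast
  then show ?thesis
  proof cases
    case 1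
    \<comment> \<open>For a conclusion on \<open>Epsilon\<close> the words \<open>u\<close> and
      \<open>w\<close> may differ, but then there are no premises; otherwise removing the stack
      symbol gives \<open>u = w\<close>.\<close>
    then have "concl r = B \<and> map (subst_atom u) (prems r) = map (subst_atom w) (prems r)"
      using B eq by (auto simp: introduction_rules_def base_conclusions_def)
    with 1 I that show ?thesis
      unfolding expansion_def by blast
  next
    case 2
    then obtain q where q: "concl r = Atom q Var"
      by (rule neutral_elimination_concl)
    obtain p t where t: "B = Atom p t" "t = Epsilon \<or> (\<exists>g \<in> \<Gamma>. t = App g Var)"
      using B unfolding base_conclusions_def by blast
    have pq: "p = q" "w = subst_trm u t"
      using eq q t by auto
    show ?thesis
    proof (rule that)
      show "subst_rule t r \<in> expansion Q \<Gamma> I"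
        using 2 I t unfolding expansion_def by blast
      show "concl (subst_rule t r) = B"
        using q t pq by (simp add: concl_subst_rule)
      show "map (subst_atom u) (prems (subst_rule t r)) = map (subst_atom w) (prems r)"
        using pq by (simp add: prems_subst_rule subst_atom_comp)
    qed
  qed
qed

text \<open>The converse passage: the substitution that formed the expanded rule is composed with
  \<open>u\<close>.\<close>

lemma instance_of_expansion:
  assumes "r' \<in> expansion Q \<Gamma> I" "word \<Gamma> u"
  obtains r w where "r \<in> I" "word \<Gamma> w" "subst_atom w (concl r) = subst_atom u (concl r')"
    "map (subst_atom w) (prems r) = map (subst_atom u) (prems r')"
proof -
  consider "r' \<in> I"
    | t r where "r' = subst_rule t r" "r \<in> I" "t = Epsilon \<or> (\<exists>g \<in> \<Gamma>. t = App g Var)"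
    using assms(1) unfolding expansion_def by blast
  then show ?thesis
  proof cases
    case 1
    with assms(2) that show ?thesis by blast
  next
    case (2 t r)
    then have "word \<Gamma> (subst_trm u t)"
      using assms(2) by (auto intro: word.intros)
    then show ?thesis
      using 2 by (intro that[of r "subst_trm u t"])
        (simp_all add: prems_subst_rule concl_subst_rule subst_atom_comp)
  qed
qed

lemma configuration_base_instance:
  assumes "configuration Q \<Gamma> A"
  obtains B u where "B \<in> base_conclusions Q \<Gamma>" "word \<Gamma> u" "A = subst_atom u B"
proof -
  obtain p w where A: "A = Atom p w" "p \<in> Q" "word \<Gamma> w"
    using assms unfolding configuration_def by blast
  from A(3) show ?thesis
  proof cases
    case 1
    show ?thesis
      \<comment> \<open>This atom contains no variable, so the choice of the word
        \<open>Epsilon\<close> is arbitrary.\<close>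
      by (rule that[of "Atom p Epsilon" Epsilon])
        (use A 1 in \<open>auto simp: base_conclusions_def intro: word.intros\<close>)
  next
    case (2 g w')
    show ?thesis
      by (rule that[of "Atom p (App g Var)" w'])
        (use A 2 in \<open>auto simp: base_conclusions_def\<close>)
  qed
qed

text \<open>Finiteness allows the rules with a given conclusion to be listed, as a rule of the
  complementation requires.\<close>

lemma finite_expansion:
  assumes "finite \<Gamma>" "finite I"
  shows "finite (expansion Q \<Gamma> I)"
proof (rule finite_subset)
  show "expansion Q \<Gamma> I \<subseteq>
      I \<union> (\<lambda>(t, r). subst_rule t r) ` (insert Epsilon ((\<lambda>g. App g Var) ` \<Gamma>) \<times> I)"
    unfolding expansion_def by auto
qed (use assms in simp)

section \<open>The two directions of the equivalence\<close>

text \<open>The induction is on the finite tree \<open>t\<close>, with \<open>c\<close> kept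
  arbitrary because \<open>c\<close> may be infinite and is replaced by one of its children at each
  step.\<close>

lemma complementation_refutes:
  assumes I: "small_step_APDS Q \<Gamma> I"
    and "finite_tree t" "derivation_tree Q \<Gamma> I t"
    and "derivation_tree Q \<Gamma> (complementation Q \<Gamma> I) c"
  shows "label c \<noteq> label t"
  using assms(2-)
proof (induction arbitrary: c)
  case (1 t)
  show ?case
  proof
    assume eq: "label c = label t"
    obtain r w where r: "r \<in> I" "label t = subst_atom w (concl r)"
      "map label (children t) = map (subst_atom w) (prems r)"
      using \<open>derivation_tree Q \<Gamma> I t\<close> by (rule derivation_tree_root)
    obtain k u where k: "k \<in> complementation Q \<Gamma> I" "label c = subst_atom u (concl k)"
      "map label (children c) = map (subst_atom u) (prems k)"
      using \<open>derivation_tree Q \<Gamma> (complementation Q \<Gamma> I) c\<close> by (rule derivation_tree_root)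
    obtain As B rs where As: "k = Rule As B" "B \<in> base_conclusions Q \<Gamma>"
      "set rs = {r \<in> expansion Q \<Gamma> I. concl r = B}"
      "list_all2 (\<lambda>A r. A \<in> set (prems r)) As rs"
      using k(1) unfolding complementation_def by blast
    have "subst_atom w (concl r) = subst_atom u B"
      using eq r(2) k(2) As(1) by simp
    \<comment> \<open>The last rule of \<open>t\<close> is reread as an expanded rule under the
      substitution \<open>u\<close> of \<open>c\<close>, so that it is among the rules from which
      \<open>k\<close> selects premises.\<close>
    then obtain r' where r': "r' \<in> expansion Q \<Gamma> I" "concl r' = B"
      "map (subst_atom u) (prems r') = map (subst_atom w) (prems r)"
      using expansion_of_instance[OF I r(1) As(2)] by metis
    have "r' \<in> set rs"
      using r' As(3) by simp
    then obtain P where P: "P \<in> set As" "P \<in> set (prems r')"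
      using As(4) by (metis in_set_conv_nth list_all2_conv_all_nth)
    have "subst_atom u P \<in> set (map (subst_atom u) (prems r'))"
      using P by simp
    then have "subst_atom u P \<in> set (map label (children t))"
      using r'(3) r(3) by simp
    moreover have "subst_atom u P \<in> set (map label (children c))"
      using k(3) As(1) P by simp
    ultimately obtain t' c' where "t' \<in> set (children t)" "c' \<in> set (children c)"
      "label c' = label t'"
      by auto
    then show False
      using "1.IH" derivation_tree_child[OF "1.prems"(1)] derivation_tree_child[OF "1.prems"(2)]
      by blast
  qed
qed

lemma unprovable_step:
  assumes "finite \<Gamma>" and I: "small_step_APDS Q \<Gamma> I"
    and A: "configuration Q \<Gamma> A" "\<not> has_proof Q \<Gamma> I A"
  obtains k u where "k \<in> complementation Q \<Gamma> I" "word \<Gamma> u" "A = subst_atom u (concl k)"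
    "\<And>P. P \<in> set (prems k) \<Longrightarrow>
      configuration Q \<Gamma> (subst_atom u P) \<and> \<not> has_proof Q \<Gamma> I (subst_atom u P)"
proof -
  obtain B u where B: "B \<in> base_conclusions Q \<Gamma>" "word \<Gamma> u" "A = subst_atom u B"
    using A(1) by (rule configuration_base_instance)
  have "finite {r \<in> expansion Q \<Gamma> I. concl r = B}"
    by (rule finite_subset[OF _ finite_expansion[OF \<open>finite \<Gamma>\<close>]])
      (use I in \<open>auto simp: small_step_APDS_def\<close>)
  then obtain rs where rs: "distinct rs" "set rs = {r \<in> expansion Q \<Gamma> I. concl r = B}"
    using finite_distinct_list by metis
  \<comment> \<open>If all premises of this instance were provable, the rule of \<open>I\<close>
    behind it would prove \<open>A\<close>.\<close>
  have "\<exists>P. P \<in> set (prems r') \<and> configuration Q \<Gamma> (subst_atom u P) \<and>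
      \<not> has_proof Q \<Gamma> I (subst_atom u P)" if "r' \<in> set rs" for r'
  proof -
    have r': "r' \<in> expansion Q \<Gamma> I" "concl r' = B"
      using that rs by auto
    obtain r w where r: "r \<in> I" "word \<Gamma> w" "subst_atom w (concl r) = A"
      "map (subst_atom w) (prems r) = map (subst_atom u) (prems r')"
      using instance_of_expansion[OF r'(1) B(2)] r'(2) B(3) by metis
    obtain P where P: "P \<in> set (prems r)" "\<not> has_proof Q \<Gamma> I (subst_atom w P)"
      using has_proof_step[OF r(1,2)] r(3) A by metis
    have "subst_atom w P \<in> subst_atom u ` set (prems r')"
      using P(1) r(4) by (metis image_eqI set_map)
    then show ?thesis
      using P premise_configuration[OF I r(1,2) P(1)] by auto
  qed
  then obtain f where f: "\<And>r'. r' \<in> set rs \<Longrightarrow> f r' \<in> set (prems r') \<and>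
      configuration Q \<Gamma> (subst_atom u (f r')) \<and> \<not> has_proof Q \<Gamma> I (subst_atom u (f r'))"
    by metis
  have "list_all2 (\<lambda>A r. A \<in> set (prems r)) (map f rs) rs"
    using f by (simp add: list_all2_conv_all_nth)
  \<comment> \<open>When no rule concludes \<open>B\<close>, the list \<open>rs\<close> is empty and
    this is the axiom for \<open>B\<close>.\<close>
  then have "Rule (map f rs) B \<in> complementation Q \<Gamma> I"
    unfolding complementation_def using B(1) rs by blast
  then show ?thesis
    using that[of "Rule (map f rs) B" u] B f by auto
qed

text \<open>Here \<open>f\<close> maps a label to the labels of its children, so one fixed choice of
  premises per configuration determines the whole, possibly infinite, tree.\<close>

primcorec unfold_tree :: "('a \<Rightarrow> 'a list) \<Rightarrow> 'a \<Rightarrow> 'a tree" where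
  "unfold_tree f a = Node a (map (unfold_tree f) (f a))"

lemma unprovable_has_coinductive_proof:
  assumes "finite \<Gamma>" and I: "small_step_APDS Q \<Gamma> I"
    and A: "configuration Q \<Gamma> A" "\<not> has_proof Q \<Gamma> I A"
  shows "has_coinductive_proof Q \<Gamma> (complementation Q \<Gamma> I) A"
proof -
  let ?U = "\<lambda>A. configuration Q \<Gamma> A \<and> \<not> has_proof Q \<Gamma> I A"
  \<comment> \<open>Placing the implication under the quantifier makes the choice function
    \<open>f\<close> total; its values outside \<open>?U\<close> are arbitrary and never reached
    from \<open>A\<close>.\<close>
  have "\<exists>Cs. ?U D \<longrightarrow> (\<exists>k \<in> complementation Q \<Gamma> I. \<exists>u. word \<Gamma> u \<and> D = subst_atom u (concl k) \<and>
      Cs = map (subst_atom u) (prems k) \<and> (\<forall>C \<in> set Cs. ?U C))" for D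
  proof (cases "?U D")
    case True
    obtain k u where "k \<in> complementation Q \<Gamma> I" "word \<Gamma> u" "D = subst_atom u (concl k)"
      "\<And>P. P \<in> set (prems k) \<Longrightarrow> ?U (subst_atom u P)"
      using True unprovable_step[OF assms(1) I] by metis
    then show ?thesis
      by (intro exI[of _ "map (subst_atom u) (prems k)"] impI bexI[of _ k] exI[of _ u]) auto
  qed blast
  then obtain f where f: "\<And>D. ?U D \<Longrightarrow> \<exists>k \<in> complementation Q \<Gamma> I. \<exists>u. word \<Gamma> u \<and>
      D = subst_atom u (concl k) \<and> f D = map (subst_atom u) (prems k) \<and> (\<forall>C \<in> set (f D). ?U C)"
    by metis
  have "derivation_tree Q \<Gamma> (complementation Q \<Gamma> I) (unfold_tree f A)"
  \<comment> \<open>The invariant is that a subtree unfolds from an unprovable configuration;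
    \<open>f\<close> preserves it by its choice of premises.\<close>
  proof (rule derivation_tree_coinduct[where X = "\<lambda>s. \<exists>D. s = unfold_tree f D \<and> ?U D"])
    fix s
    assume "\<exists>D. s = unfold_tree f D \<and> ?U D"
    then obtain D where D: "s = unfold_tree f D" "?U D"
      by blast
    have "map label (children s) = f D"
      using D by (simp add: comp_def)
    then show "configuration Q \<Gamma> (label s) \<and>
        (\<exists>r \<in> complementation Q \<Gamma> I. \<exists>w. word \<Gamma> w \<and> label s = subst_atom w (concl r) \<and>
           map label (children s) = map (subst_atom w) (prems r)) \<and>
        (\<forall>u \<in> set (children s). \<exists>D. u = unfold_tree f D \<and> ?U D)"
      using D f[OF D(2)] by auto
  qed (use A in blast)
  then show ?thesis
    unfolding has_coinductive_proof_def by (intro exI[of _ "unfold_tree f A"]) simp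
qed

theorem theorem2:
  fixes Q :: "'p set" and \<Gamma> :: "'g set"
    and I :: "('p, 'g) rule set" and A :: "('p, 'g) atom"
  assumes "finite Q" and "finite \<Gamma>"
    and "small_step_APDS Q \<Gamma> I"
    and "configuration Q \<Gamma> A"
  shows "has_coinductive_proof Q \<Gamma> (complementation Q \<Gamma> I) A \<longleftrightarrow> \<not> has_proof Q \<Gamma> I A"
proof
  assume "has_coinductive_proof Q \<Gamma> (complementation Q \<Gamma> I) A"
  then show "\<not> has_proof Q \<Gamma> I A"
    using complementation_refutes[OF assms(3)]
    unfolding has_coinductive_proof_def has_proof_def by metis
next
  assume "\<not> has_proof Q \<Gamma> I A"
  with assms(2-4) show "has_coinductive_proof Q \<Gamma> (complementation Q \<Gamma> I) A"
    by (rule unprovable_has_coinductive_proof)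
qed

end
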